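(* Let $G$ be a Polish group, let $X$ be a Polish space, and let $m$ be a continuous topological partial action of $G$ on $X$ such that $G*X$ is a $G_\delta$ subset of $G\times X$. Let $V\subseteq G$ be a nonempty open set. If $A\subseteq X$ is Borel, then the Vaught transforms $A^{\triangle V}$ and $A^{*V}$ are Borel subsets of $X$.
   Context: A partial action of a group $G$ (identity $1$) on a set $X$ is a partially defined map $m: G\times X\to X$, $(g,x)\mapsto g\cdot x$, such that, writing $\exists g\cdot x$ to mean that $(g,x)$ is in the domain of $m$, for all $g,h\in G$ and $x\in X$: (PA1) if $\exists g\cdot x$ then $\exists g^{-1}\cdot(g\cdot x)$ and $g^{-1}\cdot(g\cdot x)=x$; (PA2) if $\exists g\cdot(h\cdot x)$ then $\exists (gh)\cdot x$ and $g\cdot(h\cdot x)=(gh)\cdot x$; (PA3) $\exists 1\cdot x$ and $1\cdot x=x$. Notation: $G*X=\{(g,x)\in G\times X:\exists g\cdot x\}$ (with the subspace topology from $G\times X$); $X_{g^{-1}}=\{x\in X:\exists g\cdot x\}$; $m_g: X_{g^{-1}}\to X_g$, $x\mapsto g\cdot x$ (a bijection); $G^x=\{g\in G:\exists g\cdot x\}$. For $G$ a topological group and $X$ a topological space, the partial action is topological if each $X_g$ is open in $X$ and each $m_g$ is a homeomorphism; it is continuous if $m: G*X\to X$ is continuous. Vaught transforms: for $x\in X$ and $V\subseteq G$ put $V^x=V\cap G^x$, with the subspace topology. For $A\subseteq X$ and $V\subseteq G$ nonempty open, $$A^{\triangle V}=\{x\in X: \{g\in V^x: g\cdot x\in A\}\text{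 is not meager in }V^x\},$$ $$A^{*V}=\{x\in X: \{g\in V^x: g\cdot x\in A\}\text{ is comeager in }V^x\}.$$ (If $V^x=\emptyset$, the empty set is both meager and comeager in $V^x$.) A Polish space is a separable completely metrizable space; a Polish group is a topological group whose topology is Polish. *)

theory Defs
  imports "HOL-Algebra.Group" "HOL-Analysis.Analysis"
begin

section \<open>Polish spaces, Borel sets and Baire category for abstract topologies\<close>

definition Polish_space :: "'a topology \<Rightarrow> bool" where
  "Polish_space T \<longleftrightarrow> separable_space T \<and> completely_metrizable_space T"

definition borel_sets_of :: "'a topology \<Rightarrow> 'a set set" where
  "borel_sets_of T = sigma_sets (topspace T) {U. openin T U}"

definition nowhere_dense_in :: "'a topology \<Rightarrow> 'a set \<Rightarrow> bool" where
  "nowhere_dense_in T N \<longleftrightarrow> N \<subseteq> topspace T \<and> T interior_of (T closure_of N) = {}"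

definition meager_in :: "'a topology \<Rightarrow> 'a set \<Rightarrow> bool" where
  "meager_in T A \<longleftrightarrow> (countable union_of nowhere_dense_in T) A"

definition comeager_in :: "'a topology \<Rightarrow> 'a set \<Rightarrow> bool" where
  "comeager_in T A \<longleftrightarrow> A \<subseteq> topspace T \<and> meager_in T (topspace T - A)"

section \<open>Topological groups\<close>

locale topological_group = group G for G (structure) +
  fixes T :: "'a topology"
  assumes topspace_eq: "topspace T = carrier G"
    and continuous_mult: "continuous_map (prod_topology T T) T (\<lambda>(g, h). g \<otimes> h)"
    and continuous_inv: "continuous_map T T (\<lambda>g. inv g)"

definition Polish_group :: "('g, 'r) monoid_scheme \<Rightarrow> 'g topology \<Rightarrow> bool" where
  "Polish_group G T \<longleftrightarrow> topological_group G T \<and> Polish_space T"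

section \<open>Partial actions\<close>

text \<open>
  A partial action is a partial map \<open>m\<close>, with \<open>m (g, x) = Some y\<close> meaning that \<open>g \<cdot> x\<close> exists
  and equals \<open>y\<close>. Hence \<open>dom m\<close> is \<open>G * X\<close>.
\<close>

locale partial_action = group G for G (structure) +
  fixes X :: "'x set" and m :: "'a \<times> 'x \<rightharpoonup> 'x"
  assumes dom_subset: "dom m \<subseteq> carrier G \<times> X"
    and ran_subset: "ran m \<subseteq> X"
    and PA1: "\<lbrakk>g \<in> carrier G; x \<in> X; m (g, x) = Some y\<rbrakk> \<Longrightarrow> m (inv g, y) = Some x"
    and PA2: "\<lbrakk>g \<in> carrier G; h \<in> carrier G; x \<in> X; m (h, x) = Some y; m (g, y) = Some z\<rbrakk>
              \<Longrightarrow> m (g \<otimes> h, x) = Some z"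
    and PA3: "x \<in> X \<Longrightarrow> m (\<one>, x) = Some x"

text \<open>The set \<open>X\<^sub>g\<close>, i.e. the domain of the action of \<open>g\<inverse>\<close>.\<close>
definition pa_set :: "('g, 'r) monoid_scheme \<Rightarrow> ('g \<times> 'x \<rightharpoonup> 'x) \<Rightarrow> 'g \<Rightarrow> 'x set" where
  "pa_set G m g = {x. (inv\<^bsub>G\<^esub> g, x) \<in> dom m}"

text \<open>The set \<open>G\<^sup>x\<close>.\<close>
definition pa_elts :: "('g \<times> 'x \<rightharpoonup> 'x) \<Rightarrow> 'x \<Rightarrow> 'g set" where
  "pa_elts m x = {g. (g, x) \<in> dom m}"

definition topological_pa ::
  "('g, 'r) monoid_scheme \<Rightarrow> 'x topology \<Rightarrow> ('g \<times> 'x \<rightharpoonup> 'x) \<Rightarrow> bool" where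
  "topological_pa G X m \<longleftrightarrow>
     (\<forall>g \<in> carrier G.
        openin X (pa_set G m g) \<and>
        homeomorphic_map (subtopology X (pa_set G m (inv\<^bsub>G\<^esub> g))) (subtopology X (pa_set G m g))
          (\<lambda>x. the (m (g, x))))"

definition continuous_pa ::
  "'g topology \<Rightarrow> 'x topology \<Rightarrow> ('g \<times> 'x \<rightharpoonup> 'x) \<Rightarrow> bool" where
  "continuous_pa T X m \<longleftrightarrow>
     continuous_map (subtopology (prod_topology T X) (dom m)) X (\<lambda>p. the (m p))"

section \<open>Vaught transforms\<close>

text \<open>Here \<open>T\<close> is the topology of the group; \<open>V \<inter> pa_elts m x\<close> is \<open>V\<^sup>x\<close>.\<close>

definition Vaught_triangle ::
  "'g topology \<Rightarrow> 'x topology \<Rightarrow> ('g \<times> 'x \<rightharpoonup> 'x) \<Rightarrow> 'x set \<Rightarrow> 'g set \<Rightarrow> 'x set" where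
  "Vaught_triangle T X m A V =
     {x \<in> topspace X. \<not> meager_in (subtopology T (V \<inter> pa_elts m x))
                          {g \<in> V \<inter> pa_elts m x. the (m (g, x)) \<in> A}}"

definition Vaught_star ::
  "'g topology \<Rightarrow> 'x topology \<Rightarrow> ('g \<times> 'x \<rightharpoonup> 'x) \<Rightarrow> 'x set \<Rightarrow> 'g set \<Rightarrow> 'x set" where
  "Vaught_star T X m A V =
     {x \<in> topspace X. comeager_in (subtopology T (V \<inter> pa_elts m x))
                          {g \<in> V \<inter> pa_elts m x. the (m (g, x)) \<in> A}}"

end

theory Submission
  imports Defs
begin

text \<open>
  The proof is an induction over the Borel set \<open>A\<close>. If \<open>A\<close> is open, then \<open>{g \<in> V\<^sup>x. g \<cdot> x \<in> A}\<close> is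
  open in the Polish, hence Baire, space \<open>V\<^sup>x\<close>, so \<open>A\<^sup>\<triangle>\<^sup>V\<close> is the union over \<open>g \<in> V\<close> of the open
  sets \<open>m\<^sub>g\<inverse>(A)\<close>. The transform commutes with countable unions. For complements, since the sets
  \<open>{g \<in> G\<^sup>x. g \<cdot> x \<in> A}\<close> have the Baire property, \<open>(X - A)\<^sup>\<triangle>\<^sup>V\<close> is the union of the sets
  \<open>X\<^sup>\<triangle>\<^sup>W - A\<^sup>\<triangle>\<^sup>W\<close>, where \<open>W\<close> runs through the members contained in \<open>V\<close> of a countable base.
\<close>

section \<open>Meager sets and the Baire property\<close>

text \<open>For open \<open>U\<close>, closure and interior in the subspace are the traces on
  \<open>U\<close> of those in \<open>X\<close>. This is what later moves category questions from
  \<open>V\<^sup>x\<close> to \<open>G\<^sup>x\<close>.\<close>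

lemma nowhere_dense_in_open_subtopology:
  assumes "openin X U"
  shows "nowhere_dense_in (subtopology X U) N \<longleftrightarrow> N \<subseteq> U \<and> nowhere_dense_in X N"
proof -
  have UX: "U \<subseteq> topspace X"
    using assms openin_subset by blast
  have "subtopology X U interior_of (subtopology X U closure_of N) = U \<inter> X interior_of (X closure_of N)"
    if "N \<subseteq> U"
    using that assms by (simp add: closure_of_subtopology interior_of_subtopology_open
      inf.absorb2 interior_of_Int interior_of_openin)
  moreover have "X interior_of (X closure_of N) = {}"
    if "N \<subseteq> U" "U \<inter> X interior_of (X closure_of N) = {}"
  proof -
    \<comment> \<open>An open set that misses \<open>N\<close> misses its closure as well; the
      interior of the closure lies inside that closure, so it must be empty.\<close>
    have "X interior_of (X closure_of N) \<inter> N = {}"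
      using that by blast
    then have "X interior_of (X closure_of N) \<inter> X closure_of N = {}"
      by (simp add: openin_Int_closure_of_eq_empty)
    then show ?thesis
      using interior_of_subset by fastforce
  qed
  ultimately show ?thesis
    using UX unfolding nowhere_dense_in_def by auto
qed

lemma nowhere_dense_in_subset:
  "nowhere_dense_in X N \<Longrightarrow> M \<subseteq> N \<Longrightarrow> nowhere_dense_in X M"
  unfolding nowhere_dense_in_def
  by (metis closure_of_mono interior_of_mono order_trans subset_empty)

text \<open>An open subset of the boundary misses \<open>U\<close>, hence misses the closure of
  \<open>U\<close>, hence is empty. This bounds the error when complements are taken in
  \<open>Baire_property_in_complement\<close>.\<close>

lemma nowhere_dense_in_closure_minus_open:
  assumes "openin X U"
  shows "nowhere_dense_in X (X closure_of U - U)"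
proof -
  have "closedin X (X closure_of U - U)"
    using assms by (simp add: closedin_diff)
  moreover have "X interior_of (X closure_of U - U) = {}"
  proof -
    let ?I = "X interior_of (X closure_of U - U)"
    have "?I \<inter> U = {}"
      using interior_of_subset by fastforce
    then have "?I \<inter> X closure_of U = {}"
      by (simp add: openin_Int_closure_of_eq_empty)
    then show ?thesis
      using interior_of_subset by fastforce
  qed
  ultimately show ?thesis
    by (simp add: nowhere_dense_in_def closure_of_closedin closedin_subset)
qed

lemma meager_in_subset:
  assumes "meager_in X S" "R \<subseteq> S"
  shows "meager_in X R"
proof -
  obtain \<N> where \<N>: "countable \<N>" "\<N> \<subseteq> Collect (nowhere_dense_in X)" "\<Union>\<N> = S"
    using assms by (auto simp: meager_in_def union_of_def)
  have "countable ((\<inter>) R ` \<N>)"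
    using \<N> by simp
  moreover have "(\<inter>) R ` \<N> \<subseteq> Collect (nowhere_dense_in X)"
    using \<N> nowhere_dense_in_subset by blast
  moreover have "\<Union>((\<inter>) R ` \<N>) = R"
    using \<N> assms by blast
  ultimately show ?thesis
    unfolding meager_in_def union_of_def by blast
qed

lemma meager_in_UN:
  "countable I \<Longrightarrow> (\<And>i. i \<in> I \<Longrightarrow> meager_in X (S i)) \<Longrightarrow> meager_in X (\<Union>i\<in>I. S i)"
  unfolding meager_in_def by (rule countable_union_of_UN)

lemma meager_in_Un: "meager_in X S \<Longrightarrow> meager_in X R \<Longrightarrow> meager_in X (S \<union> R)"
  unfolding meager_in_def by (rule countable_union_of_Un)

lemma meager_in_empty: "meager_in X {}"
  unfolding meager_in_def by simp

lemma nowhere_dense_in_imp_meager_in: "nowhere_dense_in X S \<Longrightarrow> meager_in X S"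
  unfolding meager_in_def by (rule countable_union_of_inc)

lemma meager_in_open_subtopology:
  assumes "openin X U" "S \<subseteq> U"
  shows "meager_in (subtopology X U) S \<longleftrightarrow> meager_in X S"
  using assms(2)
  by (auto simp: meager_in_def union_of_def nowhere_dense_in_open_subtopology[OF assms(1)] subset_iff)

text \<open>The Baire category theorem, applied to the closures of the nowhere dense sets that cover
  \<open>U\<close>.\<close>

lemma openin_meager_in_empty:
  assumes "completely_metrizable_space X" "openin X U" "meager_in X U"
  shows "U = {}"
proof -
  obtain \<N> where \<N>: "countable \<N>" "\<N> \<subseteq> Collect (nowhere_dense_in X)" "\<Union>\<N> = U"
    using assms by (auto simp: meager_in_def union_of_def)
  have "X interior_of \<Union>((closure_of) X ` \<N>) = {}"
    using \<N> assms(1) by (intro Baire_category_alt) (auto simp: nowhere_dense_in_def)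
  moreover have "U \<subseteq> \<Union>((closure_of) X ` \<N>)"
    using \<N> by (fastforce simp: nowhere_dense_in_def dest: closure_of_subset)
  ultimately show ?thesis
    using interior_of_maximal assms(2) by blast
qed

section \<open>Sets with the Baire property\<close>

definition Baire_property_in :: "'a topology \<Rightarrow> 'a set \<Rightarrow> bool" where
  "Baire_property_in X S \<longleftrightarrow> (\<exists>U. openin X U \<and> meager_in X ((S - U) \<union> (U - S)))"

lemma openin_imp_Baire_property_in: "openin X S \<Longrightarrow> Baire_property_in X S"
  unfolding Baire_property_in_def by (rule exI[of _ S]) (simp add: meager_in_empty)

lemma Baire_property_in_complement:
  assumes "Baire_property_in X S"
  shows "Baire_property_in X (topspace X - S)"
proof -
  obtain U where U: "openin X U" "meager_in X ((S - U) \<union> (U - S))"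
    using assms by (auto simp: Baire_property_in_def)
  \<comment> \<open>If \<open>S\<close> equals \<open>U\<close> up to a meager set, then the
    complement of \<open>S\<close> equals the exterior of \<open>U\<close> up to the same set and
    the boundary of \<open>U\<close>.\<close>
  let ?W = "topspace X - X closure_of U"
  have "meager_in X (((S - U) \<union> (U - S)) \<union> (X closure_of U - U))"
    using U(2) nowhere_dense_in_imp_meager_in[OF nowhere_dense_in_closure_minus_open[OF U(1)]]
    by (rule meager_in_Un)
  moreover have "(topspace X - S - ?W) \<union> (?W - (topspace X - S))
      \<subseteq> ((S - U) \<union> (U - S)) \<union> (X closure_of U - U)"
    using closure_of_subset[OF openin_subset[OF U(1)]] by blast
  ultimately have "meager_in X ((topspace X - S - ?W) \<union> (?W - (topspace X - S)))"
    by (rule meager_in_subset)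
  moreover have "openin X ?W"
    by (simp add: openin_diff)
  ultimately show ?thesis
    unfolding Baire_property_in_def by (intro exI[of _ ?W] conjI)
qed

lemma Baire_property_in_UN:
  assumes "countable I" "\<And>i. i \<in> I \<Longrightarrow> Baire_property_in X (S i)"
  shows "Baire_property_in X (\<Union>i\<in>I. S i)"
proof -
  obtain U where U: "\<And>i. i \<in> I \<Longrightarrow> openin X (U i) \<and> meager_in X ((S i - U i) \<union> (U i - S i))"
    using assms(2) unfolding Baire_property_in_def by metis
  let ?S = "\<Union>i\<in>I. S i" and ?U = "\<Union>i\<in>I. U i"
  have "meager_in X (\<Union>i\<in>I. (S i - U i) \<union> (U i - S i))"
    using U assms(1) by (intro meager_in_UN) auto
  then have "meager_in X ((?S - ?U) \<union> (?U - ?S))"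
    by (rule meager_in_subset) blast
  moreover have "openin X ?U"
    using U by blast
  ultimately show ?thesis
    unfolding Baire_property_in_def by (intro exI[of _ ?U] conjI)
qed

text \<open>Localization: if \<open>S\<close> agrees with an open \<open>U\<close> modulo meager
  sets, then \<open>U \<inter> V\<close> is nonempty and \<open>S\<close> is comeager on it; the
  converse is Baire category. It trades non-meagerness of a set for meagerness of its complement on
  a smaller open set, which drives the complement step for Vaught transforms.\<close>

lemma nonmeager_iff_locally_comeager:
  assumes "completely_metrizable_space X" "Baire_property_in X S" "openin X V"
  shows "\<not> meager_in X (V \<inter> S) \<longleftrightarrow>
    (\<exists>W. openin X W \<and> W \<noteq> {} \<and> W \<subseteq> V \<and> meager_in X (W - S))"
proof
  assume nm: "\<not> meager_in X (V \<inter> S)"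
  obtain U where U: "openin X U" "meager_in X ((S - U) \<union> (U - S))"
    using assms by (auto simp: Baire_property_in_def)
  have "U \<inter> V \<noteq> {}"
  proof
    assume "U \<inter> V = {}"
    then have "V \<inter> S \<subseteq> (S - U) \<union> (U - S)"
      by blast
    with nm U show False
      using meager_in_subset by blast
  qed
  moreover have "meager_in X (U \<inter> V - S)"
    using U(2) by (rule meager_in_subset) blast
  ultimately show "\<exists>W. openin X W \<and> W \<noteq> {} \<and> W \<subseteq> V \<and> meager_in X (W - S)"
    using U(1) assms(3) by (intro exI[of _ "U \<inter> V"]) auto
next
  assume "\<exists>W. openin X W \<and> W \<noteq> {} \<and> W \<subseteq> V \<and> meager_in X (W - S)"
  then obtain W where W: "openin X W" "W \<noteq> {}" "W \<subseteq> V" "meager_in X (W - S)"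
    by blast
  show "\<not> meager_in X (V \<inter> S)"
  proof
    assume "meager_in X (V \<inter> S)"
    then have "meager_in X ((W - S) \<union> (V \<inter> S))"
      using W by (intro meager_in_Un)
    then have "meager_in X W"
      by (rule meager_in_subset) (use W in blast)
    with W assms(1) show False
      using openin_meager_in_empty by blast
  qed
qed

section \<open>Polish spaces\<close>

text \<open>Needed for the slice maps \<open>g \<mapsto> (g, x)\<close>, whose preimage of
  \<open>dom m\<close> is \<open>G\<^sup>x\<close>.\<close>

lemma gdelta_in_continuous_map_preimage:
  assumes "continuous_map X Y f" "gdelta_in Y S"
  shows "gdelta_in X {x \<in> topspace X. f x \<in> S}"
proof -
  obtain C where C: "\<And>n. openin Y (C n)" "\<And>n. C (Suc n) \<subseteq> C n" "\<Inter>(range C) = S"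
    using assms(2) unfolding gdelta_in_descending by blast
  let ?C = "\<lambda>n. {x \<in> topspace X. f x \<in> C n}"
  have "\<And>n. openin X (?C n)"
    using C(1) assms(1) openin_continuous_map_preimage by blast
  moreover have "\<And>n. ?C (Suc n) \<subseteq> ?C n"
    using C(2) by blast
  moreover have "\<Inter>(range ?C) = {x \<in> topspace X. f x \<in> S}"
    using C(3) by blast
  ultimately show ?thesis
    unfolding gdelta_in_descending by (intro exI[of _ ?C]) auto
qed

lemma separable_metrizable_imp_second_countable:
  assumes "separable_space X" "metrizable_space X"
  shows "second_countable X"
proof -
  obtain M d where "Metric_space M d" and X: "X = Metric_space.mtopology M d"
    using assms(2) by (auto simp: metrizable_space_def)
  then interpret Metric_space M d by simp
  obtain C where C: "countable C" "C \<subseteq> M" "mtopology closure_of C = M"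
    using assms(1) by (auto simp: separable_space_def X)
  \<comment> \<open>Balls of radius \<open>1/(n+1)\<close> around the points of a countable dense
    set form the base.\<close>
  define \<B> where "\<B> = (\<lambda>(c, n). mball c (inverse (Suc n))) ` (C \<times> (UNIV :: nat set))"
  have "countable \<B>"
    unfolding \<B>_def using C by (intro countable_image countable_SIGMA) auto
  moreover have "\<forall>V\<in>\<B>. openin X V"
    by (auto simp: \<B>_def X)
  moreover have "\<exists>V\<in>\<B>. x \<in> V \<and> V \<subseteq> U" if U: "openin X U" "x \<in> U" for U x
  proof -
    obtain r where r: "r > 0" "mball x r \<subseteq> U" and xM: "x \<in> M"
      using U unfolding X openin_mtopology by blast
    \<comment> \<open>With radius below \<open>r / 2\<close>, a basic ball that contains
      \<open>x\<close> stays within distance \<open>r\<close> of \<open>x\<close>.\<close>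
    obtain n where n: "inverse (real (Suc n)) < r / 2"
      using reals_Archimedean[of "r / 2"] r by auto
    have "\<forall>r>0. \<exists>c\<in>C. c \<in> mball x r"
      using C(3) xM unfolding metric_closure_of by blast
    moreover have "inverse (real (Suc n)) > 0"
      by simp
    ultimately obtain c where c: "c \<in> C" "c \<in> mball x (inverse (Suc n))"
      by meson
    have "mball c (inverse (Suc n)) \<subseteq> mball x r"
    proof
      fix y assume "y \<in> mball c (inverse (Suc n))"
      with c n show "y \<in> mball x r"
        using triangle[of x c y] by (auto simp del: of_nat_Suc)
    qed
    moreover have "x \<in> mball c (inverse (Suc n))"
      using c by (auto simp: commute simp del: of_nat_Suc)
    ultimately show ?thesis
      using c r unfolding \<B>_def by blast
  qed
  ultimately show ?thesis
    unfolding second_countable_def by blast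
qed

lemma sigma_algebra_borel_sets_of: "sigma_algebra (topspace X) (borel_sets_of X)"
  unfolding borel_sets_of_def
  by (rule sigma_algebra_sigma_sets) (auto dest: openin_subset)

section \<open>Vaught transforms\<close>

text \<open>The topological facts on which the induction rests: a countable base of the group, Baire
  category in each \<open>G\<^sup>x\<close>, continuity of the orbit maps
  \<open>g \<mapsto> g \<cdot> x\<close>, and continuity of each \<open>m\<^sub>g\<close> on an open
  domain.\<close>

locale Borel_Vaught =
  fixes T :: "'g topology" and X :: "'x topology" and m :: "'g \<times> 'x \<rightharpoonup> 'x"
  assumes dom_subset: "dom m \<subseteq> topspace T \<times> topspace X"
    and ran_subset: "ran m \<subseteq> topspace X"
    and second_countable: "second_countable T"
    and elts_completely_metrizable:
      "\<And>x. x \<in> topspace X \<Longrightarrow> completely_metrizable_space (subtopology T (pa_elts m x))"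
    and orbit_map_openin:
      "\<And>x U. x \<in> topspace X \<Longrightarrow> openin X U \<Longrightarrow>
        openin (subtopology T (pa_elts m x)) {g \<in> pa_elts m x. the (m (g, x)) \<in> U}"
    and translate_openin:
      "\<And>g U. g \<in> topspace T \<Longrightarrow> openin X U \<Longrightarrow>
        openin X {x \<in> topspace X. (g, x) \<in> dom m \<and> the (m (g, x)) \<in> U}"
begin

abbreviation elts :: "'x \<Rightarrow> 'g topology" where
  "elts x \<equiv> subtopology T (pa_elts m x)"

text \<open>The preimage of \<open>A\<close> under the orbit map of \<open>x\<close>. Intersecting
  with \<open>pa_elts m x\<close> keeps \<open>the\<close> away from undefined values.\<close>

definition hits :: "'x set \<Rightarrow> 'x \<Rightarrow> 'g set" where
  "hits A x = {g \<in> pa_elts m x. the (m (g, x)) \<in> A}"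

lemma elts_subset: "pa_elts m x \<subseteq> topspace T"
  using dom_subset by (auto simp: pa_elts_def)

lemma topspace_elts: "topspace (elts x) = pa_elts m x"
  using elts_subset by (simp add: inf.absorb2)

lemma the_m_in_topspace: "g \<in> pa_elts m x \<Longrightarrow> the (m (g, x)) \<in> topspace X"
  using ran_subset by (auto simp: pa_elts_def intro: ranI)

lemma hits_complement: "hits (topspace X - A) x = topspace (elts x) - hits A x"
  unfolding topspace_elts using the_m_in_topspace by (auto simp: hits_def)

lemma hits_UN: "hits (\<Union>i\<in>I. A i) x = (\<Union>i\<in>I. hits (A i) x)"
  by (auto simp: hits_def)

lemma hits_topspace: "hits (topspace X) x = pa_elts m x"
  using the_m_in_topspace by (auto simp: hits_def)

lemma openin_elts: "openin T V \<Longrightarrow> openin (elts x) (V \<inter> pa_elts m x)"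
  by (auto simp: openin_subtopology)

lemma hits_subset: "hits A x \<subseteq> pa_elts m x"
  by (auto simp: hits_def)

text \<open>Since \<open>V\<^sup>x\<close> is open in \<open>G\<^sup>x\<close>, meagerness may be
  tested in \<open>G\<^sup>x\<close>. Transforms for different \<open>V\<close> are then compared
  inside one space.\<close>

lemma Vaught_triangle_eq:
  assumes "openin T V"
  shows "Vaught_triangle T X m A V = {x \<in> topspace X. \<not> meager_in (elts x) (V \<inter> hits A x)}"
proof -
  have "meager_in (subtopology T (V \<inter> pa_elts m x)) {g \<in> V \<inter> pa_elts m x. the (m (g, x)) \<in> A}
     \<longleftrightarrow> meager_in (elts x) (V \<inter> hits A x)" for x
  proof -
    have "subtopology T (V \<inter> pa_elts m x) = subtopology (elts x) (V \<inter> pa_elts m x)"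
      by (simp add: subtopology_subtopology Int_ac)
    moreover have "{g \<in> V \<inter> pa_elts m x. the (m (g, x)) \<in> A} = V \<inter> hits A x"
      by (auto simp: hits_def)
    moreover have "V \<inter> hits A x \<subseteq> V \<inter> pa_elts m x"
      by (auto simp: hits_def)
    ultimately show ?thesis
      using meager_in_open_subtopology[OF openin_elts[OF assms]] by metis
  qed
  then show ?thesis
    by (simp add: Vaught_triangle_def)
qed

text \<open>Every \<open>g \<cdot> x\<close> lies in \<open>X\<close>, so within
  \<open>V\<^sup>x\<close> the elements that do not send \<open>x\<close> into \<open>A\<close> are
  those that send it into the complement. This reduces the star transform to the triangle.\<close>

lemma Vaught_star_eq:
  "Vaught_star T X m A V = topspace X - Vaught_triangle T X m (topspace X - A) V"
proof -
  have "comeager_in (subtopology T (V \<inter> pa_elts m x)) {g \<in> V \<inter> pa_elts m x. the (m (g, x)) \<in> A}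
     \<longleftrightarrow> meager_in (subtopology T (V \<inter> pa_elts m x))
          {g \<in> V \<inter> pa_elts m x. the (m (g, x)) \<in> topspace X - A}" for x
  proof -
    have "topspace (subtopology T (V \<inter> pa_elts m x)) = V \<inter> pa_elts m x"
      using elts_subset by auto
    moreover have "V \<inter> pa_elts m x - {g \<in> V \<inter> pa_elts m x. the (m (g, x)) \<in> A} =
        {g \<in> V \<inter> pa_elts m x. the (m (g, x)) \<in> topspace X - A}"
      using the_m_in_topspace by auto
    ultimately show ?thesis
      by (auto simp: comeager_in_def)
  qed
  then show ?thesis
    by (auto simp: Vaught_star_def Vaught_triangle_def)
qed

lemma Vaught_triangle_UN:
  fixes A :: "nat \<Rightarrow> 'x set"
  assumes "openin T V"
  shows "Vaught_triangle T X m (\<Union>i. A i) V = (\<Union>i. Vaught_triangle T X m (A i) V)"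
proof -
  have "meager_in (elts x) (V \<inter> hits (\<Union>i. A i) x) \<longleftrightarrow> (\<forall>i. meager_in (elts x) (V \<inter> hits (A i) x))"
    for x
  proof
    assume "meager_in (elts x) (V \<inter> hits (\<Union>i. A i) x)"
    then show "\<forall>i. meager_in (elts x) (V \<inter> hits (A i) x)"
      by (auto simp: hits_UN elim!: meager_in_subset)
  next
    assume "\<forall>i. meager_in (elts x) (V \<inter> hits (A i) x)"
    then have "meager_in (elts x) (\<Union>i. V \<inter> hits (A i) x)"
      by (intro meager_in_UN) auto
    then show "meager_in (elts x) (V \<inter> hits (\<Union>i. A i) x)"
      by (simp add: hits_UN)
  qed
  then show ?thesis
    by (auto simp: Vaught_triangle_eq[OF assms])
qed

lemma openin_Vaught_triangle:
  assumes V: "openin T V" and A: "openin X A"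
  shows "openin X (Vaught_triangle T X m A V)"
proof -
  have "meager_in (elts x) (V \<inter> hits A x) \<longleftrightarrow> V \<inter> hits A x = {}" if "x \<in> topspace X" for x
  proof -
    have "V \<inter> hits A x = (V \<inter> pa_elts m x) \<inter> hits A x"
      by (auto simp: hits_def)
    then have "openin (elts x) (V \<inter> hits A x)"
      using openin_elts[OF V] orbit_map_openin[OF that A] by (simp add: hits_def openin_Int)
    then show ?thesis
      using openin_meager_in_empty elts_completely_metrizable[OF that] meager_in_empty by metis
  qed
  then have "Vaught_triangle T X m A V = {x \<in> topspace X. V \<inter> hits A x \<noteq> {}}"
    by (auto simp: Vaught_triangle_eq[OF V])
  \<comment> \<open>The same relation is now sliced at fixed \<open>g\<close> instead of fixed
    \<open>x\<close>, giving the open sets \<open>m\<^sub>g\<inverse>(A)\<close>.\<close>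
  also have "\<dots> = (\<Union>g\<in>V. {x \<in> topspace X. (g, x) \<in> dom m \<and> the (m (g, x)) \<in> A})"
    unfolding hits_def pa_elts_def by blast
  finally show ?thesis
    using translate_openin[OF _ A] openin_subset[OF V] by (auto intro!: openin_Union)
qed

text \<open>By localization, \<open>x\<close> is on the left iff the preimage of \<open>A\<close> is
  meager on some nonempty open part of \<open>V\<^sup>x\<close>. That part can be shrunk to
  \<open>W\<^sup>x\<close> with \<open>W\<close> basic, and both conditions on \<open>W\<close> are
  expressed by transforms.\<close>

lemma Vaught_triangle_complement:
  assumes V: "openin T V"
    and \<B>: "\<And>W. W \<in> \<B> \<Longrightarrow> openin T W"
      "\<And>U g. openin T U \<Longrightarrow> g \<in> U \<Longrightarrow> \<exists>W\<in>\<B>. g \<in> W \<and> W \<subseteq> U"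
    and BP: "\<And>x. x \<in> topspace X \<Longrightarrow> Baire_property_in (elts x) (hits A x)"
  shows "Vaught_triangle T X m (topspace X - A) V =
    (\<Union>W\<in>{W\<in>\<B>. W \<subseteq> V}. Vaught_triangle T X m (topspace X) W - Vaught_triangle T X m A W)"
    (is "?L = ?R")
proof -
  have "x \<in> ?L \<longleftrightarrow> x \<in> ?R" if x: "x \<in> topspace X" for x
  proof -
    have cm: "completely_metrizable_space (elts x)"
      using elts_completely_metrizable[OF x] .
    \<comment> \<open>Thus \<open>X\<^sup>\<triangle>\<^sup>W\<close> records exactly that
      \<open>W\<^sup>x\<close> is nonempty.\<close>
    have nonmeager_W: "\<not> meager_in (elts x) (W \<inter> pa_elts m x) \<longleftrightarrow> W \<inter> pa_elts m x \<noteq> {}"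
      if "openin T W" for W
      using openin_meager_in_empty[OF cm openin_elts[OF that]] meager_in_empty by metis
    have "x \<in> ?L \<longleftrightarrow> \<not> meager_in (elts x) ((V \<inter> pa_elts m x) \<inter> hits (topspace X - A) x)"
      using x Vaught_triangle_eq[OF V] hits_subset by (simp add: inf.assoc inf.absorb2)
    also have "\<dots> \<longleftrightarrow> (\<exists>U. openin (elts x) U \<and> U \<noteq> {} \<and> U \<subseteq> V \<inter> pa_elts m x \<and>
        meager_in (elts x) (U - hits (topspace X - A) x))"
      using BP[OF x] openin_elts[OF V] unfolding hits_complement
      by (intro nonmeager_iff_locally_comeager cm Baire_property_in_complement)
    also have "\<dots> \<longleftrightarrow> (\<exists>W\<in>\<B>. W \<subseteq> V \<and> W \<inter> pa_elts m x \<noteq> {} \<and> meager_in (elts x) (W \<inter> hits A x))"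
      (is "?P \<longleftrightarrow> ?Q")
    proof
      assume ?P
      then obtain U g where U: "openin (elts x) U" "g \<in> U" "U \<subseteq> V"
          "meager_in (elts x) (U - hits (topspace X - A) x)"
        by blast
      then obtain U' where U': "openin T U'" "U = U' \<inter> pa_elts m x"
        by (auto simp: openin_subtopology)
      \<comment> \<open>The point \<open>g\<close> of \<open>U\<close> lies in
        \<open>G\<^sup>x\<close>, so it witnesses that \<open>W\<^sup>x\<close> is nonempty.\<close>
      obtain W where W: "W \<in> \<B>" "g \<in> W" "W \<subseteq> U' \<inter> V"
        using \<B>(2)[of "U' \<inter> V" g] U U' V by blast
      have "meager_in (elts x) (W \<inter> hits A x)"
        using U(4) by (rule meager_in_subset) (use W U' in \<open>auto simp: hits_def\<close>)
      with W U U' show ?Q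
        by blast
    next
      assume ?Q
      then obtain W where W: "W \<in> \<B>" "W \<subseteq> V" "W \<inter> pa_elts m x \<noteq> {}"
          "meager_in (elts x) (W \<inter> hits A x)"
        by blast
      \<comment> \<open>Removing from \<open>G\<^sup>x\<close> what hits the complement of
        \<open>A\<close> leaves what hits \<open>A\<close>.\<close>
      have "meager_in (elts x) (W \<inter> pa_elts m x - hits (topspace X - A) x)"
        using W(4) by (rule meager_in_subset) (use elts_subset in \<open>auto simp: hits_complement\<close>)
      with W show ?P
        using openin_elts[OF \<B>(1)[OF W(1)]] by (intro exI[of _ "W \<inter> pa_elts m x"]) auto
    qed
    also have "\<dots> \<longleftrightarrow> x \<in> ?R"
      using x \<B>(1) by (auto simp: Vaught_triangle_eq hits_topspace nonmeager_W)
    finally show ?thesis .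
  qed
  moreover have "?L \<subseteq> topspace X" "?R \<subseteq> topspace X"
    by (auto simp: Vaught_triangle_def)
  ultimately show ?thesis
    by blast
qed

text \<open>Both claims are carried through one induction because the complement step for Borelness
  uses the Baire property of the preimages of \<open>A\<close>. The quantifier over \<open>V\<close>
  stays inside, as that step for \<open>V\<close> calls on the transforms for all basic
  \<open>W \<subseteq> V\<close>.\<close>

lemma borel_sets_of_Vaught_triangle_Baire_property:
  assumes "A \<in> borel_sets_of X"
  shows "(\<forall>V. openin T V \<longrightarrow> Vaught_triangle T X m A V \<in> borel_sets_of X) \<and>
    (\<forall>x\<in>topspace X. Baire_property_in (elts x) (hits A x))"
proof -
  interpret B: sigma_algebra "topspace X" "borel_sets_of X"
    by (rule sigma_algebra_borel_sets_of)
  have open_borel: "U \<in> borel_sets_of X" if "openin X U" for U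
    using that by (auto simp: borel_sets_of_def)
  obtain \<B> where \<B>: "countable \<B>" "\<And>W. W \<in> \<B> \<Longrightarrow> openin T W"
      "\<And>U g. openin T U \<Longrightarrow> g \<in> U \<Longrightarrow> \<exists>W\<in>\<B>. g \<in> W \<and> W \<subseteq> U"
    using second_countable unfolding second_countable_def by metis
  \<comment> \<open>Besides the generators, this covers the empty set and the whole space; the
    latter supplies \<open>X\<^sup>\<triangle>\<^sup>W\<close> in the complement step.\<close>
  have op: "(\<forall>V. openin T V \<longrightarrow> Vaught_triangle T X m U V \<in> borel_sets_of X) \<and>
      (\<forall>x\<in>topspace X. Baire_property_in (elts x) (hits U x))" if "openin X U" for U
    using that openin_Vaught_triangle open_borel
    by (auto simp: hits_def intro: openin_imp_Baire_property_in orbit_map_openin)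
  from assms[unfolded borel_sets_of_def] show ?thesis
  proof induction
    case (Basic U)
    then show ?case
      using op by simp
  next
    case Empty
    show ?case
      using op by simp
  next
    case (Compl A)
    have "Vaught_triangle T X m (topspace X - A) V \<in> borel_sets_of X" if V: "openin T V" for V
    proof -
      have "countable {W\<in>\<B>. W \<subseteq> V}"
        using \<B>(1) by simp
      then have "(\<Union>W\<in>{W\<in>\<B>. W \<subseteq> V}. Vaught_triangle T X m (topspace X) W - Vaught_triangle T X m A W)
          \<in> borel_sets_of X"
        using Compl.IH op \<B>(2) by (intro B.countable_UN'' B.Diff) auto
      moreover have "Vaught_triangle T X m (topspace X - A) V =
          (\<Union>W\<in>{W\<in>\<B>. W \<subseteq> V}. Vaught_triangle T X m (topspace X) W - Vaught_triangle T X m A W)"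
        using V \<B>(2,3) Compl.IH[THEN conjunct2, rule_format] by (rule Vaught_triangle_complement)
      ultimately show ?thesis
        by simp
    qed
    moreover have "Baire_property_in (elts x) (hits (topspace X - A) x)" if "x \<in> topspace X" for x
      using Compl.IH that unfolding hits_complement by (blast intro: Baire_property_in_complement)
    ultimately show ?case
      by blast
  next
    case (Union A)
    then show ?case
      by (auto simp: Vaught_triangle_UN hits_UN intro!: Baire_property_in_UN)
  qed
qed

lemma borel_sets_of_Vaught_triangle:
  "A \<in> borel_sets_of X \<Longrightarrow> openin T V \<Longrightarrow> Vaught_triangle T X m A V \<in> borel_sets_of X"
  using borel_sets_of_Vaught_triangle_Baire_property by blast

lemma borel_sets_of_Vaught_star:
  assumes "A \<in> borel_sets_of X" "openin T V"
  shows "Vaught_star T X m A V \<in> borel_sets_of X"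
proof -
  interpret B: sigma_algebra "topspace X" "borel_sets_of X"
    by (rule sigma_algebra_borel_sets_of)
  show ?thesis
    unfolding Vaught_star_eq using assms by (intro B.compl_sets borel_sets_of_Vaught_triangle)
qed

end

section \<open>From Polish partial actions to the abstract setting\<close>

lemma Borel_Vaught_Polish_partial_action:
  fixes G :: "('g, 'r) monoid_scheme"
  assumes "Polish_group G T" "Polish_space X" "partial_action G (topspace X) m"
    and top: "topological_pa G X m" and cont: "continuous_pa T X m"
    and gd: "gdelta_in (prod_topology T X) (dom m)"
  shows "Borel_Vaught T X m"
proof -
  interpret topological_group G T
    using assms by (simp add: Polish_group_def)
  interpret pa: partial_action G "topspace X" m
    by fact
  have T: "separable_space T" "completely_metrizable_space T"
    using assms by (auto simp: Polish_group_def Polish_space_def)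
  have slice: "continuous_map T (prod_topology T X) (\<lambda>g. (g, x))" if "x \<in> topspace X" for x
    using that by (simp add: continuous_map_pairedI)
  \<comment> \<open>This exhibits \<open>G\<^sup>x\<close> as a slice of \<open>G * X\<close>, hence
    as a G-delta subset of the completely metrizable space \<open>T\<close>.\<close>
  have elts_eq: "pa_elts m x = {g \<in> topspace T. (g, x) \<in> dom m}" for x
    using pa.dom_subset by (auto simp: pa_elts_def topspace_eq)
  show ?thesis
  proof
    show "dom m \<subseteq> topspace T \<times> topspace X"
      using pa.dom_subset topspace_eq by simp
    show "ran m \<subseteq> topspace X"
      by (rule pa.ran_subset)
    show "second_countable T"
      using T by (simp add: separable_metrizable_imp_second_countable
        completely_metrizable_imp_metrizable_space)
    show "completely_metrizable_space (subtopology T (pa_elts m x))" if "x \<in> topspace X" for x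
      unfolding elts_eq
      using T(2) gdelta_in_continuous_map_preimage[OF slice[OF that] gd]
      by (rule completely_metrizable_space_gdelta_in)
    show "openin (subtopology T (pa_elts m x)) {g \<in> pa_elts m x. the (m (g, x)) \<in> U}"
      if x: "x \<in> topspace X" and U: "openin X U" for x U
    proof -
      \<comment> \<open>The orbit map is the slice map into \<open>G * X\<close> followed by the
        action, so joint continuity of the action applies.\<close>
      have "continuous_map (subtopology T (pa_elts m x)) (subtopology (prod_topology T X) (dom m))
          (\<lambda>g. (g, x))"
        using slice[OF x]
        by (auto simp: continuous_map_in_subtopology continuous_map_from_subtopology pa_elts_def)
      then have "continuous_map (subtopology T (pa_elts m x)) X ((\<lambda>p. the (m p)) \<circ> (\<lambda>g. (g, x)))"
        using cont unfolding continuous_pa_def by (rule continuous_map_compose)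
      from openin_continuous_map_preimage[OF this U]
      have "openin (subtopology T (pa_elts m x))
          {g \<in> topspace (subtopology T (pa_elts m x)). the (m (g, x)) \<in> U}"
        by (simp add: o_def)
      moreover have "topspace (subtopology T (pa_elts m x)) = pa_elts m x"
        using elts_eq by auto
      ultimately show ?thesis
        by metis
    qed
    show "openin X {x \<in> topspace X. (g, x) \<in> dom m \<and> the (m (g, x)) \<in> U}"
      if "g \<in> topspace T" and U: "openin X U" for g U
    proof -
      have g: "g \<in> carrier G"
        using that topspace_eq by simp
      \<comment> \<open>Because \<open>pa_set\<close> inverts its argument, this is the domain of
        \<open>m\<^sub>g\<close>. It is open, so sets open in it are open in
        \<open>X\<close>.\<close>
      let ?D = "pa_set G m (inv\<^bsub>G\<^esub> g)"
      have D: "?D = {x \<in> topspace X. (g, x) \<in> dom m}"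
        using g pa.dom_subset by (auto simp: pa_set_def)
      have oD: "openin X ?D"
        using top g by (simp add: topological_pa_def)
      have "continuous_map (subtopology X ?D) X (\<lambda>x. the (m (g, x)))"
        using top g unfolding topological_pa_def
        by (meson continuous_map_into_fulltopology homeomorphic_imp_continuous_map)
      from openin_continuous_map_preimage[OF this U]
      have "openin X {x \<in> topspace (subtopology X ?D). the (m (g, x)) \<in> U}"
        using oD by (rule openin_trans_full)
      moreover have "topspace (subtopology X ?D) = ?D"
        using oD openin_subset by fastforce
      ultimately show ?thesis
        unfolding D by (simp add: conj_assoc)
    qed
  qed
qed

theorem theorem3p2:
  fixes G :: "('g, 'r) monoid_scheme"
    and T :: "'g topology"
    and X :: "'x topology"
    and m :: "'g \<times> 'x \<rightharpoonup> 'x"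
    and V :: "'g set"
    and A :: "'x set"
  assumes "Polish_group G T"
    and "Polish_space X"
    and "partial_action G (topspace X) m"
    and "topological_pa G X m"
    and "continuous_pa T X m"
    and "gdelta_in (prod_topology T X) (dom m)"
    and "openin T V" and "V \<noteq> {}"
    and "A \<in> borel_sets_of X"
  shows "Vaught_triangle T X m A V \<in> borel_sets_of X \<and> Vaught_star T X m A V \<in> borel_sets_of X"
proof -
  interpret Borel_Vaught T X m
    using assms by (intro Borel_Vaught_Polish_partial_action)
  show ?thesis
    using assms borel_sets_of_Vaught_triangle borel_sets_of_Vaught_star by blast
qed

end
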